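(* Let $F=5^{2a}\cdot Q^2$ be a friend of $10$, where $a$ is a positive integer and $Q$ is an odd positive integer coprime to $15$. Then $\sigma(5^{2a})+\sigma(Q^2)\equiv 6\pmod 8$ if and only if $a$ is even.
   Context: For a positive integer $n$, $\sigma(n)$ denotes the sum of the positive divisors of $n$ and $I(n)=\sigma(n)/n$ is the abundancy index of $n$. Two distinct positive integers are friends of each other if they have the same abundancy index. Thus a friend of $10$ is a positive integer $F\neq 10$ with $I(F)=I(10)=9/5$, i.e. $5\sigma(F)=9F$. *)

theory Defs
  imports "HOL-Number_Theory.Number_Theory"
begin

definition sigma :: "nat \<Rightarrow> nat"
  where "sigma n = (\<Sum>d | d dvd n. d)"

definition abundancy :: "nat \<Rightarrow> rat"
  where "abundancy n = of_nat (sigma n) / of_nat n"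

definition friend_of :: "nat \<Rightarrow> nat \<Rightarrow> bool"
  where "friend_of m n \<longleftrightarrow> m > 0 \<and> n > 0 \<and> m \<noteq> n \<and> abundancy m = abundancy n"

end

theory Submission
  imports Defs
begin

text \<open>
  Put \<open>A = \<sigma>(5\<^sup>2\<^sup>a)\<close> and \<open>B = \<sigma>(Q\<^sup>2)\<close>. Being a friend of 10 means \<open>5 A B = 9 \<cdot> 5\<^sup>2\<^sup>a Q\<^sup>2\<close>;
  since odd squares are 1 modulo 8, this gives \<open>5 A B \<equiv> 1 (mod 8)\<close>. Summing the geometric
  series in pairs gives \<open>A \<equiv> 1 + 6 a (mod 8)\<close>. So the residue of \<open>a\<close> modulo 4 determines \<open>A\<close>, hence
  \<open>B\<close>, hence \<open>A + B\<close>, modulo 8.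
\<close>

text \<open>Multiplication maps pairs of divisors of \<open>m\<close> and \<open>n\<close> onto the
  divisors of \<open>m * n\<close>; coprimality makes this map injective, so the sum over the
  product set factors.\<close>

lemma sigma_mult_coprime:
  assumes "coprime m n"
  shows "sigma (m * n) = sigma m * sigma n"
proof -
  let ?D = "{d. d dvd m} \<times> {d. d dvd n}"
  have inj: "inj_on (\<lambda>(d, e). d * e) ?D"
  proof (rule inj_onI, clarsimp)
    fix d e d' e'
    assume dvd: "d dvd m" "d' dvd m" "e dvd n" "e' dvd n" and eq: "d * e = d' * e'"
    have "coprime d e'" "coprime d' e"
      using assms dvd by (meson coprime_divisors)+
    moreover from this have "coprime e d'" "coprime e' d"
      by (simp_all add: coprime_commute)
    ultimately show "d = d' \<and> e = e'"
      using eq by (metis coprime_crossproduct_nat mult.commute)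
  qed
  have "{d. d dvd m * n} = (\<lambda>(d, e). d * e) ` ?D"
    by (auto simp: image_iff intro: mult_dvd_mono dest: division_decomp)
  then have "sigma (m * n) = (\<Sum>(d, e)\<in>?D. d * e)"
    unfolding sigma_def using sum.reindex[OF inj, of "\<lambda>x. x"]
    by (simp add: case_prod_unfold comp_def)
  also have "\<dots> = sigma m * sigma n"
    by (simp add: sigma_def sum_product sum.cartesian_product)
  finally show ?thesis .
qed

lemma sigma_prime_power:
  assumes "prime p"
  shows "sigma (p ^ k) = (\<Sum>i\<le>k. p ^ i)"
proof -
  have inj: "inj_on (\<lambda>i. p ^ i) {..k}"
    using prime_gt_1_nat[OF assms] by (auto intro: inj_onI)
  have "{d. d dvd p ^ k} = (\<lambda>i. p ^ i) ` {..k}"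
    using divides_primepow_nat[OF assms, of _ k] by auto
  then show ?thesis
    unfolding sigma_def using sum.reindex[OF inj, of "\<lambda>x. x"] by simp
qed

lemma odd_square_mod_8:
  fixes n :: nat
  assumes "odd n"
  shows "n\<^sup>2 mod 8 = 1"
proof -
  have "n mod 8 = 1 \<or> n mod 8 = 3 \<or> n mod 8 = 5 \<or> n mod 8 = 7"
    using assms by presburger
  moreover have "n\<^sup>2 mod 8 = (n mod 8)\<^sup>2 mod 8"
    by (simp add: power_mod)
  ultimately show ?thesis by auto
qed

lemma sigma_five_even_power_mod_8: "sigma (5 ^ (2 * a)) mod 8 = (1 + 6 * a) mod 8"
proof -
  have "(\<Sum>i\<le>2 * a. 5 ^ i :: nat) mod 8 = (1 + 6 * a) mod 8"
  proof (induction a)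
    case 0
    show ?case by simp
  next
    case (Suc a)
    have "(5 ^ (2 * a) :: nat) mod 8 = 1"
      using odd_square_mod_8[of "5 ^ a"] by (simp add: power_mult mult.commute[of 2])
    \<comment> \<open>The two terms added to the series are
      \<open>5 ^ (2 * a + 1) + 5 ^ (2 * a + 2)\<close>, that is, (5 + 25) times
      \<open>5 ^ (2 * a)\<close>.\<close>
    then have "(30 * 5 ^ (2 * a) :: nat) mod 8 = 6 mod 8"
      using mod_mult_cong[of "30::nat" 8 6 "5 ^ (2 * a)" 1] by simp
    then have "((\<Sum>i\<le>2 * a. 5 ^ i) + 30 * 5 ^ (2 * a) :: nat) mod 8 = (1 + 6 * a + 6) mod 8"
      by (rule mod_add_cong[OF Suc.IH])
    then show ?case
      by (simp add: algebra_simps)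
  qed
  then show ?thesis
    by (simp add: sigma_prime_power)
qed

theorem theorem1p3:
  fixes F a Q :: nat
  assumes "F = 5 ^ (2 * a) * Q\<^sup>2"
    and "friend_of F 10"
    and "a > 0"
    and "Q > 0"
    and "odd Q"
    and "coprime Q 15"
  shows "[sigma (5 ^ (2 * a)) + sigma (Q\<^sup>2) = 6] (mod 8) \<longleftrightarrow> even a"
proof -
  define A B where "A = sigma (5 ^ (2 * a))" and "B = sigma (Q\<^sup>2)"
  have "sigma 2 = 3" "sigma 5 = 6"
    using sigma_prime_power[of 2 1] sigma_prime_power[of 5 1] by simp_all
  then have "sigma 10 = 18"
    using sigma_mult_coprime[of 2 5] by simp
  with assms(2) have "(of_nat (sigma F * 10) :: rat) = of_nat (18 * F)"
    by (auto simp: friend_of_def abundancy_def field_simps)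
  then have "sigma F * 10 = 18 * F"
    using of_nat_eq_iff by blast
  moreover have "coprime (5::nat) Q"
    using assms(6) coprime_divisors[of Q Q 5 15] by (simp add: coprime_commute)
  then have "sigma F = A * B"
    using assms(1) by (simp add: A_def B_def sigma_mult_coprime)
  \<comment> \<open>Halve the equation and write \<open>F\<close> as the square of the odd number
    \<open>5 ^ a * Q\<close>.\<close>
  ultimately have "5 * (A * B) = 9 * (5 ^ a * Q)\<^sup>2"
    using assms(1) by (simp add: power_mult_distrib power_mult mult.commute[of 2])
  moreover have "(5 ^ a * Q)\<^sup>2 mod 8 = 1"
    using assms(5) by (intro odd_square_mod_8) simp
  ultimately have "(5 * (A * B)) mod 8 = 1"
    using mod_mult_cong[of 9 8 1 "(5 ^ a * Q)\<^sup>2" 1] by simp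
  \<comment> \<open>5 is its own inverse modulo 8.\<close>
  then have AB: "((A mod 8) * (B mod 8)) mod 8 = 5"
    unfolding mod_mult_eq by presburger
  \<comment> \<open>Since 6 * 4 is a multiple of 8, only \<open>a mod 4\<close> matters.\<close>
  have "1 + 6 * a = 1 + 6 * (a mod 4) + 8 * (3 * (a div 4))"
    using mult_div_mod_eq[of 4 a] by linarith
  then have A: "A mod 8 = (1 + 6 * (a mod 4)) mod 8"
    unfolding A_def sigma_five_even_power_mod_8 by (metis mod_mult_self2)
  have "B mod 8 \<in> {..<8}" by simp
  then have B: "B mod 8 \<in> {0, 1, 2, 3, 4, 5, 6, 7}" by auto
  have "a mod 4 = 0 \<or> a mod 4 = 1 \<or> a mod 4 = 2 \<or> a mod 4 = 3"
    by linarith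
  then consider "a mod 4 = 0" "A mod 8 = 1" | "a mod 4 = 1" "A mod 8 = 7"
    | "a mod 4 = 2" "A mod 8 = 5" | "a mod 4 = 3" "A mod 8 = 3"
    using A by fastforce
  \<comment> \<open>In each case \<open>AB\<close> leaves a single residue for \<open>B\<close>: odd
    residues are self-inverse modulo 8, so B is congruent to 5 A. The sum is then 6 A, which is 6
    for A = 1, 5 and 2 for A = 3, 7.\<close>
  then have "(A mod 8 + B mod 8) mod 8 = 6 \<longleftrightarrow> even a"
  proof cases
    case 1
    then have "even a" by presburger
    then show ?thesis using 1 AB B by auto
  next
    case 2
    then have "odd a" by presburger
    then show ?thesis using 2 AB B by auto
  next
    case 3
    then have "even a" by presburger
    then show ?thesis using 3 AB B by auto
  next
    case 4
    then have "odd a" by presburger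
    then show ?thesis using 4 AB B by auto
  qed
  then show ?thesis
    by (simp add: cong_def mod_add_eq A_def B_def)
qed

end
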